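(* Let $D \ge 1$ be an integer. Let $(\alpha_t)_{t\ge 1}$ be a sequence of positive real numbers with $\alpha_t \to +\infty$ as $t \to +\infty$, and for each $t$ let $\mu_t = (\mu_{t,1},\dots,\mu_{t,D}) \in \mathbb{R}^D$. For each $t$ define the product Gaussian distributions on $\mathbb{R}^D$ $$q_t(w)=\prod_{i=1}^D \mathcal{N}(w_i \mid \mu_{t,i},\, \alpha_t\mu_{t,i}^2), \qquad q^0_t(w)=\prod_{i=1}^D \mathcal{N}(w_i \mid 0,\, \alpha_t\mu_{t,i}^2).$$ Then for every $t$ $$\mathrm{MMD}(q^0_t\,\|\,q_t)\;\le\;\sqrt{\frac{2D}{\pi}}\cdot\frac{1}{\sqrt{\alpha_t}},$$ and consequently $$\lim_{t\to+\infty}\mathrm{MMD}(q^0_t\,\|\,q_t)=0.$$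
   Context: $\mathcal{N}(\cdot \mid m, s^2)$ denotes the one-dimensional Gaussian distribution with mean $m$ and variance $s^2$ (when $s^2 = 0$, it is understood as the Dirac mass at $m$). For probability distributions $p, q$ on $\mathbb{R}^D$, the Maximum Mean Discrepancy is taken over the class of all continuous functions bounded by $1$: $$\mathrm{MMD}(p\,\|\,q)=\sup_{\substack{f \in C(\mathbb{R}^D)\\ \|f\|_\infty\le 1}} \Big(\mathbb{E}_{w\sim p} f(w)-\mathbb{E}_{w\sim q} f(w)\Big),$$ where $C(\mathbb{R}^D)$ is the set of continuous functions $f:\mathbb{R}^D\to\mathbb{R}$ and $\|f\|_\infty = \sup_{w}|f(w)|$. The distribution $q_t$ is called the Gaussian dropout posterior with dropout rate $\alpha_t$, and $q^0_t$ its zero-centered approximation. *)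

theory Defs
  imports "HOL-Probability.Probability"
begin

definition gaussian :: "real \<Rightarrow> real \<Rightarrow> real measure" where
  "gaussian m v =
     (if v = 0 then return borel m
      else density lborel (\<lambda>x. ennreal (normal_density m (sqrt v) x)))"

text \<open>The second argument of \<open>gaussian\<close> is the variance, whereas \<open>normal_density\<close>
  takes the standard deviation.\<close>

definition product_gaussian :: "real ^ 'n \<Rightarrow> real ^ 'n \<Rightarrow> (real ^ 'n) measure" where
  "product_gaussian m v =
     distr (PiM UNIV (\<lambda>i. gaussian (m $ i) (v $ i))) borel (\<lambda>x. \<chi> i. x i)"

definition dropout_posterior :: "real \<Rightarrow> real ^ 'n \<Rightarrow> (real ^ 'n) measure" where
  "dropout_posterior \<alpha> \<mu> = product_gaussian \<mu> (\<chi> i. \<alpha> * (\<mu> $ i)\<^sup>2)"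

definition zero_centered_posterior :: "real \<Rightarrow> real ^ 'n \<Rightarrow> (real ^ 'n) measure" where
  "zero_centered_posterior \<alpha> \<mu> = product_gaussian 0 (\<chi> i. \<alpha> * (\<mu> $ i)\<^sup>2)"

definition MMD :: "(real ^ 'n) measure \<Rightarrow> (real ^ 'n) measure \<Rightarrow> real" where
  "MMD p q = (SUP f \<in> {f :: real ^ 'n \<Rightarrow> real. continuous_on UNIV f \<and> (\<forall>w. \<bar>f w\<bar> \<le> 1)}.
                (\<integral>w. f w \<partial>p) - (\<integral>w. f w \<partial>q))"

text \<open>The following facts show that the constructions above are genuine: the Gaussians and their
  products are Borel probability measures, and the supremum in \<open>MMD\<close> ranges over a nonempty
  set of reals that is bounded above.\<close>

lemma sets_gaussian [simp, measurable_cong]: "sets (gaussian m v) = sets borel"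
  by (simp add: gaussian_def)

lemma space_gaussian [simp]: "space (gaussian m v) = UNIV"
  using sets_eq_imp_space_eq[OF sets_gaussian] by simp

lemma prob_space_gaussian:
  assumes "v \<ge> 0"
  shows "prob_space (gaussian m v)"
  using assms by (auto simp: gaussian_def intro!: prob_space_return prob_space_normal_density)

lemma sets_product_gaussian [simp, measurable_cong]: "sets (product_gaussian m v) = sets borel"
  by (simp add: product_gaussian_def)

lemma measurable_vec_of_fun:
  "(\<lambda>x. \<chi> i. x i) \<in> PiM UNIV (\<lambda>i. gaussian (m $ i) (v $ i)) \<rightarrow>\<^sub>M (borel :: (real ^ 'n) measure)"
proof (subst borel_measurable_euclidean_space, intro ballI)
  fix b :: "real ^ 'n" assume "b \<in> Basis"
  have "(\<lambda>x. x i) \<in> borel_measurable (PiM UNIV (\<lambda>i. gaussian (m $ i) (v $ i)))" for i :: 'n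
    using measurable_component_singleton[of i UNIV "\<lambda>i. gaussian (m $ i) (v $ i)"]
    by (simp add: measurable_cong_sets[OF refl sets_gaussian])
  then show "(\<lambda>x. (\<chi> i. x i) \<bullet> b) \<in> borel_measurable (PiM UNIV (\<lambda>i. gaussian (m $ i) (v $ i)))"
    unfolding inner_vec_def by (auto intro!: borel_measurable_sum borel_measurable_times)
qed

lemma prob_space_product_gaussian:
  fixes m v :: "real ^ 'n"
  assumes "\<And>i. v $ i \<ge> 0"
  shows "prob_space (product_gaussian m v)"
  unfolding product_gaussian_def
  by (intro prob_space.prob_space_distr prob_space_PiM measurable_vec_of_fun prob_space_gaussian assms)

lemma emeasure_product_gaussian_box:
  fixes m v :: "real ^ 'n"
  assumes v: "\<And>i. v $ i \<ge> 0" and A: "\<And>i. A i \<in> sets borel"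
  shows "emeasure (product_gaussian m v) {w. \<forall>i. w $ i \<in> A i}
           = (\<Prod>i\<in>UNIV. emeasure (gaussian (m $ i) (v $ i)) (A i))"
proof -
  interpret product_prob_space "\<lambda>i. gaussian (m $ i) (v $ i)" "UNIV :: 'n set"
    by (intro product_prob_spaceI prob_space_gaussian v)
  have B: "{w :: real ^ 'n. \<forall>i. w $ i \<in> A i} \<in> sets borel"
  proof -
    have "(\<lambda>w. w $ i) -` A i \<in> sets (borel :: (real ^ 'n) measure)" for i
      using measurable_sets[OF borel_measurable_continuous_onI A, of "\<lambda>w::real^'n. w $ i" i]
      by (simp add: continuous_on_component)
    then have "(\<Inter>i. (\<lambda>w. w $ i) -` A i) \<in> sets (borel :: (real ^ 'n) measure)"
      by (intro sets.countable_INT') auto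
    moreover have "(\<Inter>i. (\<lambda>w. w $ i) -` A i) = {w :: real ^ 'n. \<forall>i. w $ i \<in> A i}" by auto
    ultimately show ?thesis by simp
  qed
  have "emeasure (product_gaussian m v) {w. \<forall>i. w $ i \<in> A i}
          = emeasure (PiM UNIV (\<lambda>i. gaussian (m $ i) (v $ i))) (PiE UNIV A)"
    unfolding product_gaussian_def
    by (subst emeasure_distr[OF measurable_vec_of_fun B])
       (auto intro!: arg_cong2[where f = emeasure] simp: space_PiM PiE_def Pi_def)
  also have "\<dots> = (\<Prod>i\<in>UNIV. emeasure (gaussian (m $ i) (v $ i)) (A i))"
    by (intro emeasure_PiM) (auto simp: A)
  finally show ?thesis .
qed

lemma MMD_bdd_above:
  fixes p q :: "(real ^ 'n) measure"
  assumes "prob_space p" "prob_space q"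
  shows "bdd_above ((\<lambda>f :: real ^ 'n \<Rightarrow> real. (\<integral>w. f w \<partial>p) - (\<integral>w. f w \<partial>q)) `
           {f. continuous_on UNIV f \<and> (\<forall>w. \<bar>f w\<bar> \<le> 1)})"
proof -
  have *: "\<bar>\<integral>w. f w \<partial>M\<bar> \<le> 1"
    if "prob_space M" "\<forall>w. \<bar>f w\<bar> \<le> 1" for M :: "(real ^ 'n) measure" and f :: "real ^ 'n \<Rightarrow> real"
  proof (cases "integrable M f")
    case True
    interpret prob_space M by fact
    have "\<bar>\<integral>w. f w \<partial>M\<bar> \<le> (\<integral>w. \<bar>f w\<bar> \<partial>M)" by (rule integral_abs_bound)
    also have "\<dots> \<le> (\<integral>w. 1 \<partial>M)" using True that by (intro integral_mono) auto
    finally show ?thesis by (simp add: prob_space)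
  next
    case False
    then show ?thesis by (simp add: not_integrable_integral_eq)
  qed
  have "(\<integral>w. f w \<partial>p) - (\<integral>w. f w \<partial>q) \<le> 2" if "\<forall>w. \<bar>f w\<bar> \<le> 1" for f :: "real ^ 'n \<Rightarrow> real"
    using *[OF assms(1) that] *[OF assms(2) that] by linarith
  then show ?thesis by (intro bdd_aboveI[of _ 2]) auto
qed

lemma MMD_nonempty: "{f :: real ^ 'n \<Rightarrow> real. continuous_on UNIV f \<and> (\<forall>w. \<bar>f w\<bar> \<le> 1)} \<noteq> {}"
  by (auto intro!: exI[of _ "\<lambda>_. 0"])

end

theory Submission
  imports Defs
begin

text \<open>
  With \<open>s\<^sub>i = sqrt \<alpha> * \<mu>\<^sub>i\<close> and \<open>X\<close> standard normal, the zero-centered posterior is the law of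
  \<open>(s\<^sub>i X\<^sub>i)\<close> and the dropout posterior is the law of \<open>(s\<^sub>i (X\<^sub>i + c))\<close> for the same
  \<open>c = 1 / sqrt \<alpha>\<close> in every coordinate, degenerate ones included. So it suffices to compare \<open>X\<close>
  with \<open>X + c\<close>, whose law has density \<open>L = exp (c S - D c\<^sup>2 / 2)\<close> with respect to that of \<open>X\<close>,
  where \<open>S = \<Sum>i. X\<^sub>i\<close>. The extremal test function is the sign of \<open>1 - L\<close>, which depends on \<open>S\<close>
  only, and it yields \<open>2 P(- D c / 2 \<le> S < D c / 2)\<close>. As \<open>S\<close> is normal with variance \<open>D\<close>, its
  density is at most \<open>1 / sqrt (2 \<pi> D)\<close>.
\<close>

section \<open>Product measures under componentwise maps and product densities\<close>

text \<open>A product measure is determined by its values on boxes, and the preimage of a box under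
  a componentwise map is again a box.\<close>

lemma distr_PiM_componentwise:
  assumes "finite I"
    and M: "\<And>i. prob_space (M i)"
    and f [measurable]: "\<And>i. f i \<in> measurable (M i) (N i)"
  shows "distr (PiM I M) (PiM I N) (\<lambda>x. \<lambda>i\<in>I. f i (x i)) = PiM I (\<lambda>i. distr (M i) (N i) (f i))"
proof -
  interpret M: product_prob_space M
    by (intro product_prob_spaceI M)
  interpret D: product_prob_space "\<lambda>i. distr (M i) (N i) (f i)"
    by (intro product_prob_spaceI prob_space.prob_space_distr M f)
  show ?thesis
  proof (rule D.PiM_eqI)
    fix A assume "\<And>i. i \<in> I \<Longrightarrow> A i \<in> sets (distr (M i) (N i) (f i))"
    then have A [measurable]: "i \<in> I \<Longrightarrow> A i \<in> sets (N i)" for i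
      by simp
    have "(\<lambda>x. \<lambda>i\<in>I. f i (x i)) -` Pi\<^sub>E I A \<inter> space (PiM I M)
            = Pi\<^sub>E I (\<lambda>i. f i -` A i \<inter> space (M i))"
      by (auto simp: space_PiM PiE_iff)
    then show "emeasure (distr (PiM I M) (PiM I N) (\<lambda>x. \<lambda>i\<in>I. f i (x i))) (Pi\<^sub>E I A)
                 = (\<Prod>i\<in>I. emeasure (distr (M i) (N i) (f i)) (A i))"
      using assms(1) by (simp add: emeasure_distr sets_PiM_I_finite M.emeasure_PiM A)
  qed (use assms(1) in \<open>auto cong: sets_PiM_cong\<close>)
qed

text \<open>On a box the integrand is a product of functions of single coordinates, so the integral
  factorises by Tonelli; agreement on boxes determines the measure.\<close>

lemma density_PiM_prod:
  assumes "finite I"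
    and M: "\<And>i. prob_space (M i)"
    and f [measurable]: "\<And>i. f i \<in> borel_measurable (M i)"
    and D: "\<And>i. prob_space (density (M i) (f i))"
  shows "density (PiM I M) (\<lambda>x. \<Prod>i\<in>I. f i (x i)) = PiM I (\<lambda>i. density (M i) (f i))"
proof -
  interpret M: product_prob_space M
    by (intro product_prob_spaceI M)
  interpret D: product_prob_space "\<lambda>i. density (M i) (f i)"
    by (intro product_prob_spaceI D)
  have [measurable]: "(\<lambda>x. \<Prod>i\<in>I. f i (x i)) \<in> borel_measurable (PiM I M)"
    by (intro borel_measurable_prod_ennreal measurable_compose[OF _ f] measurable_component_singleton)
  show ?thesis
  proof (rule D.PiM_eqI)
    fix A assume "\<And>i. i \<in> I \<Longrightarrow> A i \<in> sets (density (M i) (f i))"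
    then have A [measurable]: "i \<in> I \<Longrightarrow> A i \<in> sets (M i)" for i
      by simp
    \<comment> \<open>Membership in \<open>Pi\<^sub>E I A\<close> also demands extensionality, which
      the product of indicators does not see; hence the restriction to the space.\<close>
    have ind: "indicator (Pi\<^sub>E I A) x = (\<Prod>i\<in>I. indicator (A i) (x i) :: ennreal)"
      if "x \<in> space (PiM I M)" for x
    proof (cases "x \<in> Pi\<^sub>E I A")
      case True
      then show ?thesis by (auto simp: PiE_iff intro!: prod.neutral[symmetric])
    next
      case False
      with that obtain i where i: "i \<in> I" "x i \<notin> A i" by (auto simp: space_PiM PiE_iff)
      have "(\<Prod>j\<in>I. indicator (A j) (x j) :: ennreal) = 0"
        using assms(1) i by (intro prod_zero) (auto simp: indicator_def)
      with False show ?thesis by simp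
    qed
    have "emeasure (density (PiM I M) (\<lambda>x. \<Prod>i\<in>I. f i (x i))) (Pi\<^sub>E I A)
            = (\<integral>\<^sup>+x. (\<Prod>i\<in>I. f i (x i) * indicator (A i) (x i)) \<partial>PiM I M)"
      using assms(1) A
      by (subst emeasure_density) (auto simp: ind prod.distrib sets_PiM_I_finite intro!: nn_integral_cong)
    also have "\<dots> = (\<Prod>i\<in>I. \<integral>\<^sup>+x. f i x * indicator (A i) x \<partial>M i)"
      using assms(1) A by (intro M.product_nn_integral_prod) auto
    also have "\<dots> = (\<Prod>i\<in>I. emeasure (density (M i) (f i)) (A i))"
      using A by (intro prod.cong) (auto simp: emeasure_density)
    finally show "emeasure (density (PiM I M) (\<lambda>x. \<Prod>i\<in>I. f i (x i))) (Pi\<^sub>E I A)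
                    = (\<Prod>i\<in>I. emeasure (density (M i) (f i)) (A i))" .
  qed (use assms(1) in \<open>auto cong: sets_PiM_cong\<close>)
qed

section \<open>Expectation gap between a measure and a density over it\<close>

text \<open>The integral of \<open>\<bar>1 - L\<bar>\<close> is twice the integral of its positive part,
  because \<open>L\<close> has mean one.\<close>

lemma integral_diff_density_le:
  fixes L F :: "'a \<Rightarrow> real"
  assumes "prob_space P"
    and L [measurable]: "L \<in> borel_measurable P" and L0: "\<And>x. L x \<ge> 0"
    and Q: "prob_space (density P L)"
    and F [measurable]: "F \<in> borel_measurable P" and F1: "\<And>x. \<bar>F x\<bar> \<le> 1"
  shows "(\<integral>x. F x \<partial>P) - (\<integral>x. F x \<partial>density P L)
           \<le> 2 * (measure P {x \<in> space P. L x < 1} - measure (density P L) {x \<in> space P. L x < 1})"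
proof -
  interpret P: prob_space P by fact
  interpret Q: prob_space "density P L" by fact
  let ?A = "{x \<in> space P. L x < 1}"
  have density_integral: "(\<integral>x. g x \<partial>density P L) = (\<integral>x. L x * g x \<partial>P)"
    if [measurable]: "g \<in> borel_measurable P" for g :: "'a \<Rightarrow> real"
    using L0 by (subst integral_density) auto
  \<comment> \<open>A bounded function is integrable under the probability measure
    \<open>density P L\<close>; reading this back under \<open>P\<close> also yields integrability
    of \<open>L\<close> itself.\<close>
  have density_integrable: "integrable P (\<lambda>x. L x * g x)"
    if [measurable]: "g \<in> borel_measurable P" and "\<And>x. \<bar>g x\<bar> \<le> 1" for g :: "'a \<Rightarrow> real"
  proof -
    have "integrable (density P L) g"
      using that by (intro Q.integrable_const_bound[of _ 1]) auto
    then show ?thesis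
      using L0 by (subst (asm) integrable_density) auto
  qed
  have intL: "integrable P L" using density_integrable[of "\<lambda>_. 1"] by simp
  have L1: "(\<integral>x. L x \<partial>P) = 1"
    using density_integral[of "\<lambda>_. 1"] Q.prob_space by simp
  have intF: "integrable P F"
    using F1 by (intro P.integrable_const_bound[of _ 1]) auto
  have intA: "integrable P (\<lambda>x. L x * indicator ?A x)"
    by (intro density_integrable) (auto simp: indicator_def)
  have intA': "integrable P (\<lambda>x. indicator ?A x :: real)"
    by (intro P.integrable_const_bound[of _ 1]) (auto simp: indicator_def)
  have "(\<integral>x. F x \<partial>P) - (\<integral>x. F x \<partial>density P L) = (\<integral>x. F x - L x * F x \<partial>P)"
    using F1 by (simp add: density_integral intF density_integrable)
  \<comment> \<open>Pointwise, \<open>F * (1 - L)\<close> is at most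
    \<open>\<bar>1 - L\<bar>\<close>, which is twice the positive part of \<open>1 - L\<close> minus
    \<open>1 - L\<close>; the last term integrates to zero.\<close>
  also have "\<dots> \<le> (\<integral>x. 2 * (indicator ?A x - L x * indicator ?A x) - (1 - L x) \<partial>P)"
  proof (intro integral_mono)
    fix x assume "x \<in> space P"
    have "F x - L x * F x = F x * (1 - L x)" by (simp add: algebra_simps)
    also have "\<dots> \<le> \<bar>F x\<bar> * \<bar>1 - L x\<bar>" by (metis abs_ge_self abs_mult)
    also have "\<dots> \<le> 1 * \<bar>1 - L x\<bar>" by (intro mult_right_mono F1) auto
    also have "\<dots> = 2 * (indicator ?A x - L x * indicator ?A x) - (1 - L x)"
      using \<open>x \<in> space P\<close> by (auto simp: indicator_def)
    finally show "F x - L x * F x \<le> 2 * (indicator ?A x - L x * indicator ?A x) - (1 - L x)" .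
  next
    show "integrable P (\<lambda>x. F x - L x * F x)"
      using F1 by (intro Bochner_Integration.integrable_diff intF density_integrable F)
    show "integrable P (\<lambda>x. 2 * (indicator ?A x - L x * indicator ?A x) - (1 - L x))"
      using intL intA intA'
      by (intro Bochner_Integration.integrable_diff integrable_mult_right P.integrable_const)
  qed
  also have "\<dots> = 2 * ((\<integral>x. indicator ?A x \<partial>P) - (\<integral>x. L x * indicator ?A x \<partial>P))"
    by (subst Bochner_Integration.integral_diff)
       (auto simp: intL intA intA' L1 P.prob_space
             simp del: Bochner_Integration.integral_indicator)
  also have "(\<integral>x. L x * indicator ?A x \<partial>P) = (\<integral>x. indicator ?A x \<partial>density P L)"
    by (rule density_integral[symmetric]) simp
  also have "2 * ((\<integral>x. indicator ?A x \<partial>P) - \<dots>) = 2 * (measure P ?A - measure (density P L) ?A)"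
    by (simp add: Int_absorb2)
  finally show ?thesis .
qed

section \<open>One-dimensional Gaussians: scaling and shifting\<close>

text \<open>Writing the variance as \<open>s\<^sup>2\<close> treats all cases at once:
  \<open>s = 0\<close> gives the Dirac mass at \<open>m\<close>, and a negative \<open>s\<close>
  enters only through \<open>sqrt (s\<^sup>2) = \<bar>s\<bar>\<close>.\<close>

lemma gaussian_affine:
  "gaussian m (s\<^sup>2) = distr (gaussian 0 1) borel (\<lambda>x. m + s * x)"
proof (cases "s = 0")
  case True
  interpret prob_space "gaussian 0 1" by (rule prob_space_gaussian) simp
  show ?thesis
    using True by (simp add: gaussian_def[of m] distr_const)
next
  case False
  interpret prob_space "gaussian 0 1" by (rule prob_space_gaussian) simp
  have "distributed (gaussian 0 1) lborel (\<lambda>x. x) (normal_density 0 1)"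
    by (simp add: distributed_def gaussian_def distr_id2)
  from normal_density_affine[OF this _ False, of m]
  show ?thesis
    using False by (simp add: distributed_def gaussian_def[of m] cong: distr_cong)
qed

text \<open>Expanding \<open>(x - c)\<^sup>2 / 2\<close> leaves the factor
  \<open>exp (c * x - c\<^sup>2 / 2)\<close>, the one-dimensional Cameron-Martin density.\<close>

lemma gaussian_shift:
  "gaussian c 1 = density (gaussian 0 1) (\<lambda>x. ennreal (exp (c * x - c\<^sup>2 / 2)))"
proof -
  have "normal_density c 1 x = normal_density 0 1 x * exp (c * x - c\<^sup>2 / 2)" for x
    by (simp add: normal_density_def exp_add[symmetric] power2_eq_square field_simps)
  then show ?thesis
    by (simp add: gaussian_def density_density_eq ennreal_mult)
qed

section \<open>The standard Gaussian in finite dimension\<close>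

text \<open>Living on functions rather than on \<open>real ^ 'n\<close>, it is literally a
  \<open>PiM\<close>, so product-measure results apply before the passage to vectors.\<close>

definition std_gaussian :: "('n::finite \<Rightarrow> real) measure" where
  "std_gaussian = PiM UNIV (\<lambda>_. gaussian 0 1)"

lemma sets_std_gaussian [simp, measurable_cong]:
  "sets (std_gaussian :: ('n::finite \<Rightarrow> real) measure) = sets (PiM UNIV (\<lambda>_. borel))"
  unfolding std_gaussian_def by (intro sets_PiM_cong) auto

lemma space_std_gaussian [simp]: "space (std_gaussian :: ('n::finite \<Rightarrow> real) measure) = UNIV"
  by (simp add: std_gaussian_def space_PiM)

lemma prob_space_std_gaussian: "prob_space (std_gaussian :: ('n::finite \<Rightarrow> real) measure)"
  unfolding std_gaussian_def by (intro prob_space_PiM prob_space_gaussian) simp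

lemma measurable_vec_of_fun_borel [measurable]:
  "(\<lambda>x. \<chi> i. x i) \<in> PiM UNIV (\<lambda>_. borel) \<rightarrow>\<^sub>M (borel :: (real ^ 'n) measure)"
proof -
  \<comment> \<open>The sigma-algebra of \<open>gaussian\<close> is the same for all parameters, so
    the instance with zero mean and variance suffices.\<close>
  have "sets (PiM UNIV (\<lambda>i::'n. gaussian ((0 :: real ^ 'n) $ i) ((0 :: real ^ 'n) $ i))) = sets (PiM UNIV (\<lambda>_. borel))"
    by (intro sets_PiM_cong) auto
  from measurable_cong_sets[OF this refl] measurable_vec_of_fun[of "0 :: real ^ 'n" "0 :: real ^ 'n"]
  show ?thesis by blast
qed

lemma measurable_affine_componentwise [measurable]:
  fixes m s :: "'n::finite \<Rightarrow> real"
  shows "(\<lambda>x i. m i + s i * x i) \<in> PiM UNIV (\<lambda>_. borel) \<rightarrow>\<^sub>M PiM UNIV (\<lambda>_. borel)"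
  by (auto intro!: measurable_PiM_single')

text \<open>Realises Gaussians with different parameters as images of one standard Gaussian, so that
  their integrals can be compared on a common space.\<close>

lemma product_gaussian_affine:
  fixes m s :: "real ^ 'n"
  shows "product_gaussian m (\<chi> i. (s $ i)\<^sup>2) = distr std_gaussian borel (\<lambda>x. \<chi> i. m $ i + s $ i * x i)"
proof -
  have "PiM UNIV (\<lambda>i. gaussian (m $ i) ((s $ i)\<^sup>2))
          = distr std_gaussian (PiM UNIV (\<lambda>_. borel)) (\<lambda>x i. m $ i + s $ i * x i)"
    unfolding gaussian_affine std_gaussian_def
    by (subst distr_PiM_componentwise[symmetric, of UNIV, unfolded restrict_UNIV]) (auto intro!: prob_space_gaussian)
  moreover have "(\<lambda>x i. m $ i + s $ i * x i) \<in> std_gaussian \<rightarrow>\<^sub>M PiM UNIV (\<lambda>_. borel)"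
    by simp
  ultimately show ?thesis
    unfolding product_gaussian_def
    by (simp add: distr_distr[OF measurable_vec_of_fun_borel] comp_def)
qed

text \<open>The Cameron-Martin formula in finite dimension: the coordinate densities multiply, so
  their exponents add.\<close>

lemma distr_std_gaussian_shift:
  fixes h :: "'n::finite \<Rightarrow> real"
  shows "distr std_gaussian (PiM UNIV (\<lambda>_. borel)) (\<lambda>x i. h i + x i)
           = density std_gaussian (\<lambda>x. ennreal (exp (\<Sum>i\<in>UNIV. h i * x i - (h i)\<^sup>2 / 2)))"
proof -
  have "distr std_gaussian (PiM UNIV (\<lambda>_. borel)) (\<lambda>x i. h i + x i)
          = PiM UNIV (\<lambda>i. distr (gaussian 0 1) borel (\<lambda>x. h i + x))"
    unfolding std_gaussian_def
    by (subst distr_PiM_componentwise[symmetric, of UNIV, unfolded restrict_UNIV]) (auto intro!: prob_space_gaussian)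
  \<comment> \<open>Both sides have the factors \<open>gaussian (h i) 1\<close>, once as an affine
    image of slope one and once as a density.\<close>
  also have "\<dots> = PiM UNIV (\<lambda>i. density (gaussian 0 1) (\<lambda>x. ennreal (exp (h i * x - (h i)\<^sup>2 / 2))))"
    unfolding gaussian_shift[symmetric] using gaussian_affine[symmetric, of _ 1] by simp
  also have "\<dots> = density std_gaussian (\<lambda>x. \<Prod>i\<in>UNIV. ennreal (exp (h i * x i - (h i)\<^sup>2 / 2)))"
    unfolding std_gaussian_def
    by (subst density_PiM_prod)
       (simp_all add: prob_space_gaussian flip: gaussian_shift)
  finally show ?thesis
    by (simp add: prod_ennreal exp_sum)
qed

lemma distributed_sum_std_gaussian:
  "distributed std_gaussian lborel (\<lambda>x. \<Sum>i\<in>(UNIV :: 'n::finite set). x i)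
     (normal_density 0 (sqrt (real CARD('n))))"
proof -
  interpret prob_space "std_gaussian :: ('n \<Rightarrow> real) measure" by (rule prob_space_std_gaussian)
  have comp: "distr std_gaussian borel (\<lambda>x. x i) = gaussian 0 1" for i :: 'n
    using distr_PiM_component[of UNIV "\<lambda>_. gaussian 0 1" i]
    by (simp add: prob_space_gaussian std_gaussian_def cong: distr_cong)
  \<comment> \<open>The joint law of the coordinates is \<open>std_gaussian\<close> itself, which is
    the product of its marginals.\<close>
  have "indep_vars (\<lambda>_. borel) (\<lambda>i x. x i) (UNIV :: 'n set)"
    by (subst indep_vars_iff_distr_eq_PiM)
       (auto simp: comp restrict_UNIV std_gaussian_def[symmetric] intro!: distr_id2)
  moreover have "distributed std_gaussian lborel (\<lambda>x. x i) (normal_density 0 1)" for i :: 'n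
    using comp[of i] by (simp add: distributed_def gaussian_def cong: distr_cong)
  ultimately show ?thesis
    using sum_indep_normal[of UNIV "\<lambda>i x. x i" "\<lambda>_. 1" "\<lambda>_. 0"] by simp
qed

text \<open>The normal density is largest at its mean, with value
  \<open>1 / (sqrt (2 * pi) * \<sigma>)\<close>; this is multiplied by the length of the
  interval.\<close>

lemma measure_normal_interval_le:
  assumes "distributed M lborel X (normal_density m \<sigma>)" "\<sigma> > 0" "a \<le> b"
  shows "measure M {x \<in> space M. a \<le> X x \<and> X x < b} \<le> (b - a) / (sqrt (2 * pi) * \<sigma>)"
proof -
  have X [measurable]: "X \<in> borel_measurable M"
    using distributed_measurable[OF assms(1)] by simp
  have "emeasure M {x \<in> space M. a \<le> X x \<and> X x < b} = emeasure M (X -` {a..<b} \<inter> space M)"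
    by (intro arg_cong2[where f = emeasure]) auto
  also have "\<dots> = (\<integral>\<^sup>+x. ennreal (normal_density m \<sigma> x) * indicator {a..<b} x \<partial>lborel)"
    by (rule distributed_emeasure[OF assms(1)]) auto
  also have "\<dots> \<le> (\<integral>\<^sup>+x. ennreal (1 / (sqrt (2 * pi) * \<sigma>)) * indicator {a..<b} x \<partial>lborel)"
    using assms(2)
    by (intro nn_integral_mono mult_right_mono ennreal_leI)
       (auto simp: normal_density_def real_sqrt_mult divide_right_mono)
  also have "\<dots> = ennreal ((b - a) / (sqrt (2 * pi) * \<sigma>))"
    using assms by (simp add: nn_integral_cmult ennreal_mult[symmetric])
  finally show ?thesis
    using assms(2,3) by (simp add: measure_def enn2real_leI)
qed

section \<open>The bound for a diagonal shift\<close>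

lemma std_gaussian_shift_integral_diff_le:
  fixes F :: "('n::finite \<Rightarrow> real) \<Rightarrow> real"
  assumes c: "c > 0"
    and F [measurable]: "F \<in> borel_measurable (PiM UNIV (\<lambda>_. borel))" and F1: "\<And>x. \<bar>F x\<bar> \<le> 1"
  shows "(\<integral>x. F x \<partial>std_gaussian) - (\<integral>x. F (\<lambda>i. c + x i) \<partial>std_gaussian)
           \<le> sqrt (2 * real CARD('n) / pi) * c"
proof -
  interpret P: prob_space "std_gaussian :: ('n \<Rightarrow> real) measure" by (rule prob_space_std_gaussian)
  let ?P = "std_gaussian :: ('n \<Rightarrow> real) measure"
  let ?D = "real CARD('n)"
  define S where "S = (\<lambda>x :: 'n \<Rightarrow> real. \<Sum>i\<in>UNIV. x i)"
  define L where "L = (\<lambda>x :: 'n \<Rightarrow> real. exp (\<Sum>i\<in>UNIV. c * x i - c\<^sup>2 / 2))"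
  define Q where "Q = distr ?P (PiM UNIV (\<lambda>_. borel)) (\<lambda>x i. c + x i)"
  have [measurable]: "S \<in> borel_measurable (PiM UNIV (\<lambda>_. borel))"
    "L \<in> borel_measurable (PiM UNIV (\<lambda>_. borel))"
    "(\<lambda>x i. c + x i) \<in> PiM UNIV (\<lambda>_::'n. borel) \<rightarrow>\<^sub>M PiM UNIV (\<lambda>_. borel)"
    unfolding S_def L_def by (measurable, auto intro!: measurable_PiM_single')
  have Q: "Q = density ?P L"
    unfolding Q_def L_def by (rule distr_std_gaussian_shift)
  have probQ: "prob_space Q"
    unfolding Q_def by (rule P.prob_space_distr) simp
  \<comment> \<open>Factoring \<open>c > 0\<close> out of the exponent makes \<open>L x < 1\<close>
    a half-space condition on the sum \<open>S\<close>.\<close>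
  have "L x = exp (c * (S x - ?D * c / 2))" for x
    by (simp add: L_def S_def sum_subtractf sum_distrib_left power2_eq_square algebra_simps)
  then have Lless: "L x < 1 \<longleftrightarrow> S x < ?D * c / 2" for x
    using c by (simp add: mult_less_0_iff)
  have sets_S: "{x. S x < k} \<in> sets (PiM UNIV (\<lambda>_. borel))" for k
    using measurable_sets[of S "PiM UNIV (\<lambda>_. borel)" borel "{..<k}"]
    by (simp add: vimage_def space_PiM)
  have Sshift: "S (\<lambda>i. c + x i) = ?D * c + S x" for x
    by (simp add: S_def sum.distrib)
  have "(\<integral>x. F x \<partial>?P) - (\<integral>x. F (\<lambda>i. c + x i) \<partial>?P) = (\<integral>x. F x \<partial>?P) - (\<integral>x. F x \<partial>Q)"
    by (simp add: Q_def integral_distr)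
  also have "\<dots> \<le> 2 * (measure ?P {x. S x < ?D * c / 2} - measure Q {x. S x < ?D * c / 2})"
    using integral_diff_density_le[of ?P L F] probQ F1 P.prob_space_axioms
    by (simp add: Q Lless) (simp add: L_def)
  \<comment> \<open>The shift raises \<open>S\<close> by \<open>?D * c\<close>, so the threshold
    drops from \<open>?D * c / 2\<close> to its negative.\<close>
  also have "measure Q {x. S x < ?D * c / 2} = measure ?P {x. S x < - (?D * c / 2)}"
    unfolding Q_def
    by (subst measure_distr[OF _ sets_S]) (auto simp: Sshift field_simps intro!: arg_cong2[where f = measure])
  also have "measure ?P {x. S x < ?D * c / 2} - measure ?P {x. S x < - (?D * c / 2)}
               = measure ?P ({x. S x < ?D * c / 2} - {x. S x < - (?D * c / 2)})"
  proof (intro P.finite_measure_Diff[symmetric])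
    have "- (?D * c / 2) \<le> ?D * c / 2"
      using c by simp
    then show "{x. S x < - (?D * c / 2)} \<subseteq> {x. S x < ?D * c / 2}"
      by (auto simp del: divide_minus_left)
  qed (simp_all only: sets_std_gaussian sets_S)
  also have "\<dots> = measure ?P {x \<in> space ?P. - (?D * c / 2) \<le> S x \<and> S x < ?D * c / 2}"
    by (intro arg_cong2[where f = measure]) auto
  \<comment> \<open>The interval has length \<open>?D * c\<close> and the deviation of
    \<open>S\<close> is \<open>sqrt ?D\<close>, so one factor \<open>sqrt ?D\<close>
    survives.\<close>
  also have "\<dots> \<le> (?D * c / 2 - - (?D * c / 2)) / (sqrt (2 * pi) * sqrt ?D)"
    using c unfolding S_def
    by (intro measure_normal_interval_le[OF distributed_sum_std_gaussian]) auto
  also have "2 * \<dots> = sqrt (2 * ?D / pi) * c"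
    by (simp add: real_sqrt_mult real_sqrt_divide field_simps)
  finally show ?thesis by simp
qed

section \<open>From the shift bound to the posteriors\<close>

text \<open>The zero function is an admissible test function. This supplies the lower side of the
  final squeeze.\<close>

lemma MMD_nonneg:
  fixes p q :: "(real ^ 'n) measure"
  assumes "prob_space p" "prob_space q"
  shows "MMD p q \<ge> 0"
  unfolding MMD_def
  by (rule cSUP_upper2[OF MMD_bdd_above[OF assms], of "\<lambda>_. 0"]) auto

lemma prob_space_posteriors:
  assumes "\<alpha> \<ge> 0"
  shows "prob_space (zero_centered_posterior \<alpha> \<mu>)" "prob_space (dropout_posterior \<alpha> \<mu>)"
  unfolding zero_centered_posterior_def dropout_posterior_def
  using assms by (auto intro!: prob_space_product_gaussian)

text \<open>Each test function \<open>f\<close> pulls back to \<open>f \<circ> g\<close>, still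
  bounded by one; the scales are absorbed into \<open>g\<close>, and the shift bound is uniform over
  such functions.\<close>

lemma MMD_dropout_le:
  fixes \<mu> :: "real ^ 'n"
  assumes \<alpha>: "\<alpha> > 0"
  shows "MMD (zero_centered_posterior \<alpha> \<mu>) (dropout_posterior \<alpha> \<mu>)
           \<le> sqrt (2 * real CARD('n) / pi) * (1 / sqrt \<alpha>)"
  unfolding MMD_def
proof (rule cSUP_least[OF MMD_nonempty])
  fix f :: "real ^ 'n \<Rightarrow> real"
  assume f: "f \<in> {f. continuous_on UNIV f \<and> (\<forall>w. \<bar>f w\<bar> \<le> 1)}"
  define c where "c = 1 / sqrt \<alpha>"
  \<comment> \<open>The scale keeps the sign of \<open>\<mu> $ i\<close>, so
    \<open>\<mu> $ i = s $ i * c\<close> holds in every coordinate, while the variances see only its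
    square.\<close>
  define s where "s = (\<chi> i. sqrt \<alpha> * \<mu> $ i)"
  define g where "g = (\<lambda>x :: 'n \<Rightarrow> real. \<chi> i. s $ i * x i)"
  have s2: "(\<chi> i. \<alpha> * (\<mu> $ i)\<^sup>2) = (\<chi> i. (s $ i)\<^sup>2)"
    using \<alpha> by (simp add: s_def power_mult_distrib)
  have \<mu>: "\<mu> $ i = s $ i * c" for i
    using \<alpha> by (simp add: s_def c_def)
  have [measurable]: "f \<in> borel_measurable borel"
    using f by (auto intro: borel_measurable_continuous_onI)
  have aff [measurable]: "(\<lambda>x. \<chi> i. m i + s $ i * x i) \<in> PiM UNIV (\<lambda>_. borel) \<rightarrow>\<^sub>M borel" for m :: "'n \<Rightarrow> real"
    by (rule measurable_compose[OF measurable_affine_componentwise measurable_vec_of_fun_borel])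
  have [measurable]: "g \<in> PiM UNIV (\<lambda>_. borel) \<rightarrow>\<^sub>M borel"
    using aff[of "\<lambda>_. 0"] by (simp add: g_def)
  have "(\<integral>w. f w \<partial>zero_centered_posterior \<alpha> \<mu>) = (\<integral>x. f (g x) \<partial>std_gaussian)"
    unfolding zero_centered_posterior_def s2 product_gaussian_affine
    using aff[of "\<lambda>_. 0"] by (subst integral_distr) (auto simp: g_def)
  moreover have "(\<integral>w. f w \<partial>dropout_posterior \<alpha> \<mu>) = (\<integral>x. f (g (\<lambda>i. c + x i)) \<partial>std_gaussian)"
    unfolding dropout_posterior_def s2 product_gaussian_affine
    by (subst integral_distr) (auto simp: g_def \<mu> distrib_left)
  moreover have "(\<integral>x. f (g x) \<partial>std_gaussian) - (\<integral>x. f (g (\<lambda>i. c + x i)) \<partial>std_gaussian)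
                   \<le> sqrt (2 * real CARD('n) / pi) * c"
    using \<alpha> f by (intro std_gaussian_shift_integral_diff_le) (auto simp: c_def)
  ultimately show "(\<integral>w. f w \<partial>zero_centered_posterior \<alpha> \<mu>) - (\<integral>w. f w \<partial>dropout_posterior \<alpha> \<mu>)
      \<le> sqrt (2 * real CARD('n) / pi) * (1 / sqrt \<alpha>)"
    by (simp add: c_def)
qed

theorem theorem1:
  fixes \<alpha> :: "nat \<Rightarrow> real" and \<mu> :: "nat \<Rightarrow> real ^ 'n"
  assumes "\<And>t. t \<ge> 1 \<Longrightarrow> \<alpha> t > 0"
    and "filterlim \<alpha> at_top sequentially"
  shows "(\<forall>t\<ge>1. MMD (zero_centered_posterior (\<alpha> t) (\<mu> t)) (dropout_posterior (\<alpha> t) (\<mu> t))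
                   \<le> sqrt (2 * real CARD('n) / pi) * (1 / sqrt (\<alpha> t)))
       \<and> (\<lambda>t. MMD (zero_centered_posterior (\<alpha> t) (\<mu> t)) (dropout_posterior (\<alpha> t) (\<mu> t)))
           \<longlonglongrightarrow> 0"
proof
  show bound: "\<forall>t\<ge>1. MMD (zero_centered_posterior (\<alpha> t) (\<mu> t)) (dropout_posterior (\<alpha> t) (\<mu> t))
                   \<le> sqrt (2 * real CARD('n) / pi) * (1 / sqrt (\<alpha> t))"
    using MMD_dropout_le assms(1) by blast
  have "filterlim (\<lambda>t. sqrt (\<alpha> t)) at_top sequentially"
    by (rule filterlim_compose[OF sqrt_at_top assms(2)])
  then have "(\<lambda>t. 1 / sqrt (\<alpha> t)) \<longlonglongrightarrow> 0"
    using tendsto_divide_0[OF tendsto_const, of "\<lambda>t. sqrt (\<alpha> t)" sequentially "1::real"]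
    by (auto intro: filterlim_at_top_imp_at_infinity)
  then have lim: "(\<lambda>t. sqrt (2 * real CARD('n) / pi) * (1 / sqrt (\<alpha> t))) \<longlonglongrightarrow> 0"
    by (rule tendsto_mult_right_zero)
  show "(\<lambda>t. MMD (zero_centered_posterior (\<alpha> t) (\<mu> t)) (dropout_posterior (\<alpha> t) (\<mu> t))) \<longlonglongrightarrow> 0"
  proof (rule tendsto_sandwich[OF _ _ tendsto_const lim])
    \<comment> \<open>Positivity of \<open>\<alpha> t\<close> is given from \<open>t = 1\<close> on,
      so the lower bound is claimed only eventually.\<close>
    show "\<forall>\<^sub>F t in sequentially. 0 \<le> MMD (zero_centered_posterior (\<alpha> t) (\<mu> t)) (dropout_posterior (\<alpha> t) (\<mu> t))"
      using eventually_ge_at_top[of 1]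
      by eventually_elim (use assms(1) in \<open>auto intro!: MMD_nonneg prob_space_posteriors simp: less_imp_le\<close>)
  qed (use bound in \<open>auto simp: eventually_sequentially\<close>)
qed

end
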